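(* Let $(V,\omega)$ be a finite-dimensional real symplectic vector space, and let $Q,P\subset V$ be strictly convex closed $C^1$-smooth hypersurfaces containing the origin in their interiors. Assume that $Q$ and $P$ coincide, $P=Q$. Let $\varphi_S$ be the symplectic billiard map with respect to $Q$ and let $\varphi_M$ be the (symplectic version of the) Minkowski billiard map with respect to the pair $(Q,P)=(Q,Q)$. Then $\varphi_M=\varphi_S^2=\varphi_S\circ\varphi_S$.
   Context: A strictly convex closed $C^1$-smooth hypersurface in $V$ is the $C^1$-smooth boundary of a compact convex body with nonempty interior that contains no line segment; its "interior" is the interior of that body. For such a hypersurface $Q$ containing the origin in its interior and $q\in Q$, let $R(q)\in V$ be the unique vector with $\omega(u,R(q))=0$ for all $u\in T_qQ$ and $\omega(q,R(q))=1$. It spans the characteristic direction at $q$, i.e. the kernel of $\omega|_{T_qQ}$. For $p\in P$, $R(p)$ is defined in the same way using $P$. Write $a\sim b$ if $a=cb$ for some $c>0$. Minkowski billiard map in symplectic space, for a pair $(Q,P)$ of such hypersurfaces in $V$: the phase space is $\mathcal S=\{(q,p)\mid q\in Q,\ p\in P,\ \omega(R(q),R(p))>0\}$, and $\varphi_M:\mathcal S\to\mathcal S$ sends $(q,p)$ to $(q_1,p_1)$, where $q_1\in Q$ and $p_1\in P$ are determined by $q_1-q\sim R(p)$ and $p_1-p\sim R(q_1)$. Symplectic billiard map with respect to $Q$: on the phase space $\{(x,y)\in Q\times Q\mid \omega(R(x),R(y))>0\}$ (which is $\mathcal S$ for $P=Q$), $\varphi_S(x,y)=(y,z)$, where $z\in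 Q$, $z\ne x$, is the point such that $z-x$ is parallel to the characteristic direction of $Q$ at $y$ (on this phase space, $z-x\sim R(y)$). *)

theory Defs
  imports "HOL-Analysis.Analysis"
begin

definition symplectic_form :: "('a::euclidean_space \<Rightarrow> 'a \<Rightarrow> real) \<Rightarrow> bool" where
  "symplectic_form \<omega> \<longleftrightarrow>
     bilinear \<omega> \<and> (\<forall>v. \<omega> v v = 0) \<and> (\<forall>u. (\<forall>v. \<omega> u v = 0) \<longrightarrow> u = 0)"

definition local_C1_equation ::
  "'a::euclidean_space set \<Rightarrow> 'a \<Rightarrow> 'a set \<Rightarrow> ('a \<Rightarrow> real) \<Rightarrow> ('a \<Rightarrow> 'a \<Rightarrow>\<^sub>L real) \<Rightarrow> bool" where
  "local_C1_equation Q q U f f' \<longleftrightarrow>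
     open U \<and> q \<in> U \<and>
     (\<forall>x\<in>U. (f has_derivative blinfun_apply (f' x)) (at x)) \<and> continuous_on U f' \<and>
     f' q \<noteq> 0 \<and> Q \<inter> U = {x \<in> U. f x = 0}"

definition C1_hypersurface :: "'a::euclidean_space set \<Rightarrow> bool" where
  "C1_hypersurface Q \<longleftrightarrow> (\<forall>q\<in>Q. \<exists>U f f'. local_C1_equation Q q U f f')"

text \<open>The tangent space is the kernel of the differential of a local equation; this kernel does
  not depend on the choice of the equation.\<close>

definition tangent_space :: "'a::euclidean_space set \<Rightarrow> 'a \<Rightarrow> 'a set" where
  "tangent_space Q q =
     {v. \<exists>U f f'. local_C1_equation Q q U f f' \<and> blinfun_apply (f' q) v = 0}"

definition bounds_strictly_convex_C1_body :: "'a::euclidean_space set \<Rightarrow> 'a set \<Rightarrow> bool" where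
  "bounds_strictly_convex_C1_body Q K \<longleftrightarrow>
     compact K \<and> convex K \<and> interior K \<noteq> {} \<and> Q = frontier K \<and> C1_hypersurface Q \<and>
     (\<forall>a b. a \<noteq> b \<longrightarrow> \<not> closed_segment a b \<subseteq> Q)"

definition strictly_convex_closed_C1_hypersurface :: "'a::euclidean_space set \<Rightarrow> bool" where
  "strictly_convex_closed_C1_hypersurface Q \<longleftrightarrow> (\<exists>K. bounds_strictly_convex_C1_body Q K)"

text \<open>The interior of the body bounded by \<open>Q\<close> (not the topological interior of \<open>Q\<close>, which is
  empty). The body is determined by \<open>Q\<close>.\<close>

definition hypersurface_interior :: "'a::euclidean_space set \<Rightarrow> 'a set" where
  "hypersurface_interior Q = {x. \<exists>K. bounds_strictly_convex_C1_body Q K \<and> x \<in> interior K}"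

definition characteristic_direction ::
  "('a::euclidean_space \<Rightarrow> 'a \<Rightarrow> real) \<Rightarrow> 'a set \<Rightarrow> 'a \<Rightarrow> 'a set" where
  "characteristic_direction \<omega> Q q =
     {v \<in> tangent_space Q q. \<forall>u\<in>tangent_space Q q. \<omega> u v = 0}"

definition char_vector :: "('a::euclidean_space \<Rightarrow> 'a \<Rightarrow> real) \<Rightarrow> 'a set \<Rightarrow> 'a \<Rightarrow> 'a" where
  "char_vector \<omega> Q q = (THE r. (\<forall>u\<in>tangent_space Q q. \<omega> u r = 0) \<and> \<omega> q r = 1)"

definition same_ray :: "'a::real_vector \<Rightarrow> 'a \<Rightarrow> bool" where
  "same_ray a b \<longleftrightarrow> (\<exists>c>0. a = c *\<^sub>R b)"

definition phase_space ::
  "('a::euclidean_space \<Rightarrow> 'a \<Rightarrow> real) \<Rightarrow> 'a set \<Rightarrow> 'a set \<Rightarrow> ('a \<times> 'a) set" where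
  "phase_space \<omega> Q P =
     {(q, p). q \<in> Q \<and> p \<in> P \<and> \<omega> (char_vector \<omega> Q q) (char_vector \<omega> P p) > 0}"

text \<open>Both billiard maps are extensional: they take the value \<open>undefined\<close> outside their phase space.
  Hence equality of such maps is equality on the phase space.\<close>

definition minkowski_billiard_map ::
  "('a::euclidean_space \<Rightarrow> 'a \<Rightarrow> real) \<Rightarrow> 'a set \<Rightarrow> 'a set \<Rightarrow> 'a \<times> 'a \<Rightarrow> 'a \<times> 'a" where
  "minkowski_billiard_map \<omega> Q P =
     (\<lambda>(q, p)\<in>phase_space \<omega> Q P.
        THE (q1, p1). q1 \<in> Q \<and> p1 \<in> P \<and>
          same_ray (q1 - q) (char_vector \<omega> P p) \<and> same_ray (p1 - p) (char_vector \<omega> Q q1))"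

definition symplectic_billiard_map ::
  "('a::euclidean_space \<Rightarrow> 'a \<Rightarrow> real) \<Rightarrow> 'a set \<Rightarrow> 'a \<times> 'a \<Rightarrow> 'a \<times> 'a" where
  "symplectic_billiard_map \<omega> Q =
     (\<lambda>(x, y)\<in>phase_space \<omega> Q Q.
        (y, THE z. z \<in> Q \<and> z \<noteq> x \<and> z - x \<in> characteristic_direction \<omega> Q y))"

end

theory Submission imports Defs begin

text \<open>With a supporting functional \<open>m\<close> of the body \<open>K\<close> at \<open>q\<close>, the vector \<open>R q\<close> satisfies
  \<open>\<omega> v (R q) = (m \<bullet> v) / (m \<bullet> q)\<close>. Thus \<open>\<omega> (R x) (R y) > 0\<close> says that the line from \<open>x\<close> in
  direction \<open>R y\<close> enters the interior of \<open>K\<close> at \<open>x\<close>, so it leaves \<open>K\<close> at exactly one further point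
  \<open>z = x + c R y\<close>, where \<open>c > 0\<close>. As it leaves \<open>K\<close> at \<open>z\<close>, \<open>\<omega> (R y) (R z) > 0\<close>. So \<open>z\<close> is defined by
  the same condition for both billiard maps, and \<open>(y, z)\<close> is again in the phase space; the second
  half of the Minkowski map is a second symplectic billiard step.\<close>

section \<open>Tangent spaces and supporting functionals\<close>

lemma obtain_transversal:
  fixes Q :: "'a::euclidean_space set"
  assumes "local_C1_equation Q q U f f'"
  obtains e where "blinfun_apply (f' q) e = 1"
proof -
  have "f' q \<noteq> 0" using assms by (simp add: local_C1_equation_def)
  then obtain v where v: "blinfun_apply (f' q) v \<noteq> 0"
    by (metis blinfun_eqI zero_blinfun.rep_eq)
  then have "blinfun_apply (f' q) (v /\<^sub>R blinfun_apply (f' q) v) = 1"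
    by (simp add: blinfun.scaleR_right)
  then show ?thesis by (rule that)
qed

text \<open>For small \<open>t > 0\<close>, \<open>f\<close> changes sign between \<open>q + t (u - \<epsilon> e)\<close> and \<open>q + t (u + \<epsilon> e)\<close> if \<open>e\<close> is
  transversal to the hypersurface, so \<open>Q\<close> has a point close to \<open>q + t u\<close>; no implicit function
  theorem is needed.\<close>

lemma support_le_zero_on_kernel:
  fixes Q :: "'a::euclidean_space set"
  assumes eqn: "local_C1_equation Q q U f f'" and q: "q \<in> Q"
    and u: "blinfun_apply (f' q) u = 0"
    and m: "\<And>x. x \<in> Q \<Longrightarrow> m \<bullet> x \<le> m \<bullet> q"
  shows "m \<bullet> u \<le> 0"
proof (rule ccontr)
  assume "\<not> m \<bullet> u \<le> 0"
  then have mu: "m \<bullet> u > 0" by simp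
  obtain e where e: "blinfun_apply (f' q) e = 1" using obtain_transversal[OF eqn] .
  have U: "open U" "q \<in> U" "Q \<inter> U = {x \<in> U. f x = 0}"
    and df: "\<And>x. x \<in> U \<Longrightarrow> (f has_derivative blinfun_apply (f' x)) (at x)"
    using eqn by (auto simp: local_C1_equation_def)
  have fq: "f q = 0" using U q by blast
  \<comment> \<open>Small enough that \<open>m\<close> stays positive on \<open>u + s e\<close> for
    all |s| \<le> \<epsilon>; the summand 1 covers the case that \<open>m\<close> vanishes on
    \<open>e\<close>.\<close>
  define \<epsilon> where "\<epsilon> = m \<bullet> u / (1 + \<bar>m \<bullet> e\<bar>)"
  have \<epsilon>: "\<epsilon> > 0" "\<epsilon> * \<bar>m \<bullet> e\<bar> < m \<bullet> u"
    using mu by (auto simp: \<epsilon>_def field_simps add_pos_nonneg)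
  have dline: "((\<lambda>t. f (q + t *\<^sub>R v)) has_real_derivative blinfun_apply (f' q) v) (at 0)" for v
  proof -
    have "((\<lambda>t. f (q + t *\<^sub>R v)) has_derivative (\<lambda>t. blinfun_apply (f' q) (t *\<^sub>R v))) (at 0)"
      by (rule has_derivative_compose[where g = f]) (auto intro!: derivative_eq_intros df U)
    then show ?thesis
      by (simp add: has_field_derivative_def blinfun.scaleR_right mult.commute[of _ "blinfun_apply (f' q) v"])
  qed
  have dp: "((\<lambda>t. f (q + t *\<^sub>R (u + \<epsilon> *\<^sub>R e))) has_real_derivative \<epsilon>) (at 0)"
    using dline[of "u + \<epsilon> *\<^sub>R e"] by (simp add: blinfun.add_right blinfun.scaleR_right u e)
  have dn: "((\<lambda>t. f (q + t *\<^sub>R (u + (-\<epsilon>) *\<^sub>R e))) has_real_derivative -\<epsilon>) (at 0)"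
    using dline[of "u + (-\<epsilon>) *\<^sub>R e"] by (simp only: blinfun.add_right blinfun.scaleR_right u e) simp
  obtain d1 where d1: "d1 > 0" "\<And>h. 0 < h \<Longrightarrow> h < d1 \<Longrightarrow> f (q + h *\<^sub>R (u + \<epsilon> *\<^sub>R e)) > 0"
    using DERIV_pos_inc_right[OF dp] \<epsilon> fq by auto
  obtain d2 where d2: "d2 > 0" "\<And>h. 0 < h \<Longrightarrow> h < d2 \<Longrightarrow> f (q + h *\<^sub>R (u + (-\<epsilon>) *\<^sub>R e)) < 0"
    using DERIV_neg_dec_right[OF dn] \<epsilon> fq by auto
  obtain r where r: "r > 0" "ball q r \<subseteq> U" using U openE by blast
  \<comment> \<open>\<open>N\<close> is positive and bounds the norm of \<open>u + s e\<close> for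
    |s| \<le> \<epsilon>, so \<open>t * N < r\<close> keeps the whole segment in
    \<open>U\<close>.\<close>
  define N where "N = norm u + \<epsilon> * norm e + 1"
  have N: "N > 0" using \<epsilon> by (simp add: N_def add_nonneg_pos)
  have "0 < Min {d1, d2, r / N}" using d1(1) d2(1) r N by simp
  from dense[OF this] obtain t where "0 < t" "t < Min {d1, d2, r / N}" by (elim exE conjE)
  then have t: "t > 0" "t < d1" "t < d2" "t * N < r" using N by (simp_all add: pos_less_divide_eq)
  have inU: "q + t *\<^sub>R (u + s *\<^sub>R e) \<in> U" if "-\<epsilon> \<le> s" "s \<le> \<epsilon>" for s
  proof -
    have "norm (u + s *\<^sub>R e) \<le> norm u + \<bar>s\<bar> * norm e"
      by (metis norm_scaleR norm_triangle_ineq)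
    also have "\<dots> \<le> norm u + \<epsilon> * norm e" using that by (auto intro!: mult_right_mono)
    also have "\<dots> \<le> N" by (simp add: N_def)
    finally have "t * norm (u + s *\<^sub>R e) \<le> t * N" using t(1) by simp
    then have "t * norm (u + s *\<^sub>R e) < r" using t(4) by linarith
    then have "norm (t *\<^sub>R (u + s *\<^sub>R e)) < r" using t(1) by simp
    then have "q + t *\<^sub>R (u + s *\<^sub>R e) \<in> ball q r" by (simp add: dist_norm)
    then show ?thesis using r by blast
  qed
  have "isCont (\<lambda>s. f (q + t *\<^sub>R (u + s *\<^sub>R e))) s" if "-\<epsilon> \<le> s" "s \<le> \<epsilon>" for s
  proof (rule isCont_o2[where g = f])
    show "isCont f (q + t *\<^sub>R (u + s *\<^sub>R e))"
      using df[OF inU[OF that]] has_derivative_continuous by blast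
  qed (intro continuous_intros)
  then have "\<exists>s. -\<epsilon> \<le> s \<and> s \<le> \<epsilon> \<and> f (q + t *\<^sub>R (u + s *\<^sub>R e)) = 0"
    using d1(2)[OF t(1,2)] d2(2)[OF t(1,3)] \<epsilon>(1) by (intro IVT) auto
  then obtain s where s: "-\<epsilon> \<le> s" "s \<le> \<epsilon>" "f (q + t *\<^sub>R (u + s *\<^sub>R e)) = 0" by blast
  \<comment> \<open>Here \<open>m\<close> would be larger than at \<open>q\<close>, by the choice of
    \<epsilon>.\<close>
  have "q + t *\<^sub>R (u + s *\<^sub>R e) \<in> Q" using s inU U by blast
  then have "t * (m \<bullet> u + s * (m \<bullet> e)) \<le> 0"
    using m by (fastforce simp: inner_add_right)
  then have "m \<bullet> u + s * (m \<bullet> e) \<le> 0" using t by (simp add: mult_le_0_iff)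
  moreover have "\<bar>s * (m \<bullet> e)\<bar> \<le> \<epsilon> * \<bar>m \<bullet> e\<bar>"
    unfolding abs_mult using s by (intro mult_right_mono) auto
  ultimately show False using \<epsilon> by linarith
qed

text \<open>The one-sided bound, applied to \<open>v\<close> and \<open>- v\<close>, makes
  \<open>m\<close> vanish on the kernel of every local equation. Both functionals are nonzero, so
  the two kernels are the same hyperplane.\<close>

lemma tangent_space_eq_support:
  fixes Q :: "'a::euclidean_space set"
  assumes Q: "C1_hypersurface Q" "q \<in> Q" and m: "m \<noteq> 0" "\<And>x. x \<in> Q \<Longrightarrow> m \<bullet> x \<le> m \<bullet> q"
  shows "tangent_space Q q = {v. m \<bullet> v = 0}"
proof -
  have ker: "m \<bullet> v = 0" if "local_C1_equation Q q U f f'" "blinfun_apply (f' q) v = 0" for U f f' v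
    using support_le_zero_on_kernel[OF that(1) Q(2) that(2) m(2)]
      support_le_zero_on_kernel[OF that(1) Q(2) _ m(2), of "- v"] that(2)
    by (simp add: blinfun.minus_right)
  show ?thesis
  proof (intro subset_antisym subsetI)
    fix v assume "v \<in> tangent_space Q q"
    then show "v \<in> {v. m \<bullet> v = 0}" using ker by (auto simp: tangent_space_def)
  next
    fix v assume v: "v \<in> {v. m \<bullet> v = 0}"
    obtain U f f' where eqn: "local_C1_equation Q q U f f'"
      using Q by (auto simp: C1_hypersurface_def)
    obtain e where e: "blinfun_apply (f' q) e = 1" using obtain_transversal[OF eqn] .
    \<comment> \<open>Projecting \<open>w\<close> along \<open>e\<close> lands in the kernel, where
      \<open>m\<close> vanishes; hence \<open>m\<close> is a multiple of the differential.\<close>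
    have split: "m \<bullet> w = blinfun_apply (f' q) w * (m \<bullet> e)" for w
      using ker[OF eqn, of "w - blinfun_apply (f' q) w *\<^sub>R e"]
      by (simp add: blinfun.diff_right blinfun.scaleR_right e inner_diff_right)
    have "m \<bullet> e \<noteq> 0" using split[of m] m(1) by auto
    then have "blinfun_apply (f' q) v = 0" using split[of v] v by simp
    then show "v \<in> tangent_space Q q" using eqn by (auto simp: tangent_space_def)
  qed
qed

section \<open>Linear algebra of the symplectic form\<close>

lemma symplectic_form_antisym:
  assumes "symplectic_form \<omega>"
  shows "\<omega> u v = - \<omega> v u"
proof -
  have b: "bilinear \<omega>" and a: "\<And>v. \<omega> v v = 0" using assms by (auto simp: symplectic_form_def)
  have "\<omega> (u + v) (u + v) = \<omega> u u + \<omega> u v + (\<omega> v u + \<omega> v v)"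
    by (simp add: bilinear_ladd[OF b] bilinear_radd[OF b])
  then show ?thesis using a by simp
qed

text \<open>Nondegeneracy makes the map from \<open>r\<close> to the Riesz vector of the functional
  \<omega>(-, r) injective, hence surjective in finite dimension.\<close>

lemma symplectic_form_represents:
  fixes \<omega> :: "'a::euclidean_space \<Rightarrow> 'a \<Rightarrow> real"
  assumes "symplectic_form \<omega>"
  shows "\<exists>r. \<forall>v. \<omega> v r = m \<bullet> v"
proof -
  have b: "bilinear \<omega>" using assms by (simp add: symplectic_form_def)
  define L where "L r = (\<Sum>i\<in>Basis. \<omega> i r *\<^sub>R i)" for r
  have L: "\<omega> v r = L r \<bullet> v" for v r
  proof -
    have lin: "linear (\<lambda>v. \<omega> v r)" using b by (simp add: bilinear_def)
    have "\<omega> v r = \<omega> (\<Sum>i\<in>Basis. (v \<bullet> i) *\<^sub>R i) r" by (simp add: euclidean_representation)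
    also have "\<dots> = (\<Sum>i\<in>Basis. (v \<bullet> i) * \<omega> i r)"
      by (simp add: linear_sum[OF lin] linear_scale[OF lin])
    also have "\<dots> = L r \<bullet> v"
      by (simp add: L_def inner_sum_left inner_commute[of v] mult.commute)
    finally show ?thesis .
  qed
  have "linear L"
    by (rule linearI)
      (simp_all add: L_def bilinear_radd[OF b] bilinear_rmul[OF b] scaleR_left_distrib
        sum.distrib scaleR_sum_right)
  moreover have "inj L"
    unfolding linear_injective_0[OF \<open>linear L\<close>]
  proof (intro allI impI)
    fix r assume "L r = 0"
    then have "\<omega> r v = 0" for v using L[of v r] symplectic_form_antisym[OF assms, of r v] by simp
    then show "r = 0" using assms by (auto simp: symplectic_form_def)
  qed
  ultimately have "surj L" by (simp add: linear_injective_imp_surjective)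
  then obtain r where "L r = m" by (metis surjD)
  then show ?thesis using L by auto
qed

text \<open>Nondegeneracy is stated for the first argument; antisymmetry carries it over to the
  second.\<close>

lemma symplectic_form_right_cancel:
  assumes \<omega>: "symplectic_form \<omega>" and eq: "\<And>v. \<omega> v r = \<omega> v s"
  shows "r = s"
proof -
  have b: "bilinear \<omega>" using \<omega> by (simp add: symplectic_form_def)
  have "\<omega> (r - s) v = 0" for v
    using eq[of v] symplectic_form_antisym[OF \<omega>, of "r - s" v] by (simp add: bilinear_rsub[OF b])
  then have "r - s = 0" using \<omega> unfolding symplectic_form_def by blast
  then show ?thesis by simp
qed

section \<open>Supporting functionals and the characteristic vector\<close>

locale symplectic_body =
  fixes \<omega> :: "'a::euclidean_space \<Rightarrow> 'a \<Rightarrow> real" and Q K :: "'a set"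
  assumes form: "symplectic_form \<omega>"
    and compact: "compact K" and convex: "convex K"
    and frontier: "Q = frontier K" and C1: "C1_hypersurface Q"
    and zero_interior: "0 \<in> interior K"
begin

abbreviation "R \<equiv> char_vector \<omega> Q"

lemma bilinear: "bilinear \<omega>"
  using form by (simp add: symplectic_form_def)

lemma Q_subset: "Q \<subseteq> K"
  using frontier compact compact_imp_closed frontier_subset_closed by blast

lemma Q_not_interior: "q \<in> Q \<Longrightarrow> q \<notin> interior K"
  using frontier by (simp add: frontier_def)

lemma ray_towards_frontier_in_interior:
  assumes "x \<in> K" "x + t *\<^sub>R v \<in> interior K" "0 < s" "s \<le> t"
  shows "x + s *\<^sub>R v \<in> interior K"
proof -
  have "x - (s / t) *\<^sub>R (x - (x + t *\<^sub>R v)) \<in> interior K"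
    using assms by (intro mem_interior_convex_shrink convex) auto
  moreover have "x - (s / t) *\<^sub>R (x - (x + t *\<^sub>R v)) = x + s *\<^sub>R v"
    using assms by (auto simp: scaleR_right_diff_distrib)
  ultimately show ?thesis by metis
qed

lemma support_less:
  assumes "m \<noteq> 0" "\<And>x. x \<in> K \<Longrightarrow> m \<bullet> x \<le> b" "x \<in> interior K"
  shows "m \<bullet> x < b"
proof -
  obtain e where e: "e > 0" "cball x e \<subseteq> K" using assms(3) mem_interior_cball by blast
  \<comment> \<open>The step from \<open>x\<close> to \<open>x + d m\<close> has length exactly
    \<open>e\<close>, so it stays in \<open>K\<close> while \<open>m\<close> strictly grows.\<close>
  define d where "d = e / norm m"
  have "x + d *\<^sub>R m \<in> cball x e" using e assms(1) by (simp add: dist_norm d_def)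
  then have "m \<bullet> (x + d *\<^sub>R m) \<le> b" using assms(2) e by blast
  moreover have "d * (m \<bullet> m) > 0" using e assms(1) by (simp add: d_def)
  ultimately show ?thesis by (simp add: inner_add_right)
qed

lemma exists_support:
  assumes "q \<in> Q"
  obtains m where "m \<noteq> 0" "\<And>x. x \<in> K \<Longrightarrow> m \<bullet> x \<le> m \<bullet> q"
proof -
  have "q \<in> closure K" "q \<notin> rel_interior K"
    using assms frontier rel_interior_nonempty_interior[of K] zero_interior
    by (auto simp: frontier_def)
  then obtain a where a: "a \<noteq> 0" "\<And>x. x \<in> closure K \<Longrightarrow> a \<bullet> q \<le> a \<bullet> x"
    using supporting_hyperplane_rel_boundary[OF convex_closure[OF convex]] convex
    by (metis convex_rel_interior_closure)
  \<comment> \<open>The library functional is minimal at \<open>q\<close>; its negative is an outer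
    normal.\<close>
  then have "- a \<bullet> x \<le> - a \<bullet> q" if "x \<in> K" for x
    using that closure_subset by (force simp: inner_minus_left)
  then show ?thesis using that[of "- a"] a by auto
qed

text \<open>The tangent space is the kernel of \<open>m\<close>, and together with \<open>q\<close>
  it spans the space. So the two conditions on \<open>R q\<close> determine the functional
  \<omega>(-, R q), and the normalised \<open>m\<close> satisfies them.\<close>

lemma char_vector_support:
  assumes q: "q \<in> Q" and m: "m \<noteq> 0" "\<And>x. x \<in> K \<Longrightarrow> m \<bullet> x \<le> m \<bullet> q"
  shows "m \<bullet> q > 0" "\<omega> v (R q) = (m \<bullet> v) / (m \<bullet> q)"
    "tangent_space Q q = {v. \<omega> v (R q) = 0}"
proof -
  show pos: "m \<bullet> q > 0" using support_less[OF m zero_interior] by simp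
  have T: "tangent_space Q q = {v. m \<bullet> v = 0}"
    using tangent_space_eq_support[OF C1 q m(1)] m(2) Q_subset by blast
  obtain r where r: "\<And>v. \<omega> v r = (m /\<^sub>R (m \<bullet> q)) \<bullet> v"
    using symplectic_form_represents[OF form] by blast
  have "R q = r" unfolding char_vector_def
  proof (rule the_equality)
    show "(\<forall>u\<in>tangent_space Q q. \<omega> u r = 0) \<and> \<omega> q r = 1"
      using pos by (auto simp: r T)
  next
    fix s assume s: "(\<forall>u\<in>tangent_space Q q. \<omega> u s = 0) \<and> \<omega> q s = 1"
    show "s = r"
    proof (rule symplectic_form_right_cancel[OF form])
      fix v
      \<comment> \<open>Projection of \<open>v\<close> along \<open>q\<close> onto the tangent
        space.\<close>
      have "v - ((m \<bullet> v) / (m \<bullet> q)) *\<^sub>R q \<in> tangent_space Q q"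
        using pos by (simp add: T inner_diff_right)
      then have "\<omega> (v - ((m \<bullet> v) / (m \<bullet> q)) *\<^sub>R q) s = 0" using s by blast
      then show "\<omega> v s = \<omega> v r"
        using s by (simp add: r bilinear_lsub[OF bilinear] bilinear_lmul[OF bilinear] field_simps)
    qed
  qed
  then show *: "\<omega> v (R q) = (m \<bullet> v) / (m \<bullet> q)" for v by (simp add: r field_simps)
  show "tangent_space Q q = {v. \<omega> v (R q) = 0}" using pos by (auto simp: T *)
qed

text \<open>These facts no longer mention \<open>m\<close>: the set where \<omega>(-, R q) equals 1
  is a supporting hyperplane at \<open>q\<close>.\<close>

lemma
  assumes q: "q \<in> Q"
  shows char_vector_self: "\<omega> q (R q) = 1"
    and tangent_space_eq: "tangent_space Q q = {v. \<omega> v (R q) = 0}"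
    and char_vector_less: "x \<in> interior K \<Longrightarrow> \<omega> x (R q) < 1"
proof -
  obtain m where m: "m \<noteq> 0" "\<And>x. x \<in> K \<Longrightarrow> m \<bullet> x \<le> m \<bullet> q"
    by (rule exists_support[OF q]) simp
  note R = char_vector_support[OF q m]
  show "\<omega> q (R q) = 1" "tangent_space Q q = {v. \<omega> v (R q) = 0}" using R by auto
  show "x \<in> interior K \<Longrightarrow> \<omega> x (R q) < 1" using support_less[OF m] R by simp
qed

lemma char_vector_nonzero: "q \<in> Q \<Longrightarrow> R q \<noteq> 0"
  using char_vector_self bilinear_rzero[OF bilinear] by fastforce

text \<open>The tangent space is the \<omega>-orthogonal complement of \<open>R q\<close>, and its
  own complement is again the line through \<open>R q\<close>.\<close>

lemma characteristic_direction_eq: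
  assumes q: "q \<in> Q"
  shows "characteristic_direction \<omega> Q q = range (\<lambda>c. c *\<^sub>R R q)"
proof (intro subset_antisym subsetI)
  fix v assume "v \<in> characteristic_direction \<omega> Q q"
  then have v: "\<And>u. \<omega> u (R q) = 0 \<Longrightarrow> \<omega> u v = 0"
    by (simp add: characteristic_direction_def tangent_space_eq[OF q])
  have "v = \<omega> q v *\<^sub>R R q"
  proof (rule symplectic_form_right_cancel[OF form])
    fix u
    have "\<omega> (u - \<omega> u (R q) *\<^sub>R q) v = 0"
      by (rule v) (simp add: bilinear_lsub[OF bilinear] bilinear_lmul[OF bilinear]
          char_vector_self[OF q])
    then show "\<omega> u v = \<omega> u (\<omega> q v *\<^sub>R R q)"
      by (simp add: bilinear_lsub[OF bilinear] bilinear_lmul[OF bilinear]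
          bilinear_rmul[OF bilinear])
  qed
  then show "v \<in> range (\<lambda>c. c *\<^sub>R R q)" by blast
next
  fix v assume "v \<in> range (\<lambda>c. c *\<^sub>R R q)"
  moreover have "\<omega> (R q) (R q) = 0" using form by (simp add: symplectic_form_def)
  ultimately show "v \<in> characteristic_direction \<omega> Q q"
    by (auto simp: characteristic_direction_def tangent_space_eq[OF q]
        bilinear_lmul[OF bilinear] bilinear_rmul[OF bilinear])
qed

section \<open>Chords of the body\<close>

text \<open>A ray that misses the interior is separated from it by a hyperplane supporting \<open>K\<close> at \<open>q\<close>, and
  smoothness leaves only the tangent hyperplane for this.\<close>

lemma ray_enters_interior:
  assumes q: "q \<in> Q" and v: "\<omega> v (R q) < 0"
  obtains t where "t > 0" "q + t *\<^sub>R v \<in> interior K"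
proof (rule ccontr)
  assume "\<not> thesis"
  with that have out: "q + t *\<^sub>R v \<notin> interior K" if "t > 0" for t using \<open>t > 0\<close> by blast
  define S where "S = (\<lambda>t. q + t *\<^sub>R v) ` {0<..}"
  have "convex S"
  proof -
    have "convex ((+) q ` (\<lambda>t. t *\<^sub>R v) ` {0<..})"
      by (intro convex_translation convex_linear_image) (auto intro: linearI simp: scaleR_left_distrib)
    then show ?thesis by (simp add: S_def image_image)
  qed
  moreover have "S \<noteq> {}" "interior K \<inter> S = {}" using out by (auto simp: S_def)
  ultimately obtain a b where ab: "a \<noteq> 0" "\<And>x. x \<in> interior K \<Longrightarrow> a \<bullet> x \<le> b" "\<And>x. x \<in> S \<Longrightarrow> a \<bullet> x \<ge> b"
    using separating_hyperplane_sets[of "interior K" S] convex_interior[OF convex] zero_interior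
    by blast
  have "K = closure (interior K)"
    using convex_closure_interior[OF convex] zero_interior compact compact_imp_closed closure_closed
    by blast
  then have Kb: "a \<bullet> x \<le> b" if "x \<in> K" for x
    using closure_minimal[of "interior K" "{x. a \<bullet> x \<le> b}"] that closed_halfspace_le ab(2) by blast
  have ray: "b \<le> a \<bullet> q + t * (a \<bullet> v)" if "t > 0" for t
    using ab(3)[of "q + t *\<^sub>R v"] that by (auto simp: S_def inner_add_right)
  have aq: "a \<bullet> q \<le> b" using Kb q Q_subset by blast
  \<comment> \<open>Letting t tend to 0 along the ray shows that the separating hyperplane passes
    through \<open>q\<close>, so it supports \<open>K\<close> there.\<close>
  have bq: "b \<le> a \<bullet> q"
  proof (rule tendsto_lowerbound)
    show "((\<lambda>t. a \<bullet> q + t * (a \<bullet> v)) \<longlongrightarrow> a \<bullet> q) (at_right 0)"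
      by (auto intro!: tendsto_eq_intros)
    show "\<forall>\<^sub>F t in at_right 0. b \<le> a \<bullet> q + t * (a \<bullet> v)"
      using ray by (auto simp: eventually_at_filter)
  qed simp
  have "a \<bullet> v \<ge> 0" using ray[of 1] aq by simp
  moreover have "a \<bullet> x \<le> a \<bullet> q" if "x \<in> K" for x using Kb[OF that] bq by simp
  ultimately have "\<omega> v (R q) \<ge> 0" using char_vector_support(1,2)[OF q ab(1)] by simp
  then show False using v by simp
qed

text \<open>The ray enters the interior and must leave the bounded body again; a line through an
  interior point meets the frontier at most twice.\<close>

lemma exists_chord_endpoint:
  assumes x: "x \<in> Q" and v: "\<omega> v (R x) < 0"
  obtains c where "c > 0" "x + c *\<^sub>R v \<in> Q" "\<And>d. x + d *\<^sub>R v \<in> Q \<Longrightarrow> d = 0 \<or> d = c"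
    "\<omega> v (R (x + c *\<^sub>R v)) > 0"
proof -
  have xK: "x \<in> K" using x Q_subset by blast
  obtain t where t: "t > 0" "x + t *\<^sub>R v \<in> interior K" using ray_enters_interior[OF x v] .
  have "v \<noteq> 0" using v bilinear_lzero[OF bilinear] by auto
  then obtain d where d: "d > 0" "(x + t *\<^sub>R v) + d *\<^sub>R v \<in> frontier K"
    using ray_to_frontier[OF compact_imp_bounded[OF compact] t(2), of v] by blast
  define c where "c = t + d"
  have c: "c > t" "x + c *\<^sub>R v \<in> Q" using d frontier by (simp_all add: c_def algebra_simps)
  \<comment> \<open>The interior point at parameter \<open>t\<close> splits the segment: up to
    \<open>t\<close> it is seen from \<open>x\<close>, beyond \<open>t\<close> from the far end
    \<open>x + e v\<close>.\<close>
  have below: "x + s *\<^sub>R v \<in> interior K" if s: "0 < s" "s < e" "x + e *\<^sub>R v \<in> K" for s e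
  proof (cases "s \<le> t")
    case True
    then show ?thesis using ray_towards_frontier_in_interior[OF xK t(2)] s by blast
  next
    case False
    have "(x + e *\<^sub>R v) + (e - s) *\<^sub>R (- v) \<in> interior K"
    proof (rule ray_towards_frontier_in_interior[OF s(3)])
      show "(x + e *\<^sub>R v) + (e - t) *\<^sub>R (- v) \<in> interior K" using t by (simp add: algebra_simps)
    qed (use s False in auto)
    then show ?thesis by (simp add: algebra_simps)
  qed
  show ?thesis
  proof (rule that)
    show "c > 0" using c t by simp
    show "x + c *\<^sub>R v \<in> Q" by (fact c)
    show "d = 0 \<or> d = c" if d: "x + d *\<^sub>R v \<in> Q" for d
    proof (rule ccontr)
      assume "\<not> ?thesis"
      then consider "d < 0" | "0 < d" "d < c" | "c < d" by linarith
      then show False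
      proof cases
        case 1
        \<comment> \<open>Otherwise \<open>x\<close> lies strictly between a point of
          \<open>Q\<close> and an interior point.\<close>
        have "(x + d *\<^sub>R v) + (- d) *\<^sub>R v \<in> interior K"
        proof (rule ray_towards_frontier_in_interior)
          show "(x + d *\<^sub>R v) + (t - d) *\<^sub>R v \<in> interior K" using t by (simp add: algebra_simps)
        qed (use 1 d t Q_subset in auto)
        then show ?thesis using Q_not_interior[OF x] by (simp add: algebra_simps)
      next
        case 2
        then show ?thesis using below c d Q_subset Q_not_interior by blast
      next
        case 3
        \<comment> \<open>With \<open>c\<close> and \<open>d\<close> exchanged,
          \<open>x + c v\<close> would be interior.\<close>
        then show ?thesis using below[of c d] c d t Q_subset Q_not_interior[OF c(2)] by auto
      qed
    qed
    \<comment> \<open>The functional belonging to the exit point is below 1 at the interior point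
      and equals 1 at the exit, so it increases along \<open>v\<close>.\<close>
    have "\<omega> (x + t *\<^sub>R v) (R (x + c *\<^sub>R v)) < 1" by (rule char_vector_less[OF c(2) t(2)])
    moreover have "\<omega> (x + t *\<^sub>R v) (R (x + c *\<^sub>R v))
      = \<omega> (x + c *\<^sub>R v) (R (x + c *\<^sub>R v)) - (c - t) * \<omega> v (R (x + c *\<^sub>R v))"
      by (simp add: bilinear_ladd[OF bilinear] bilinear_lmul[OF bilinear] algebra_simps)
    ultimately have "(c - t) * \<omega> v (R (x + c *\<^sub>R v)) > 0" using char_vector_self[OF c(2)] by simp
    then show "\<omega> v (R (x + c *\<^sub>R v)) > 0" using c by (simp add: zero_less_mult_iff)
  qed
qed

section \<open>The two billiard maps\<close>

text \<open>The symplectic map allows any nonzero multiple of \<open>R y\<close>, the Minkowski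
  condition only positive ones. The line has just one further point of \<open>Q\<close>, at a
  positive parameter, so both select it.\<close>

lemma symplectic_billiard_step:
  assumes xy: "(x, y) \<in> phase_space \<omega> Q Q"
  shows "\<exists>z. symplectic_billiard_map \<omega> Q (x, y) = (y, z) \<and> (y, z) \<in> phase_space \<omega> Q Q \<and>
    (\<forall>z'. z' \<in> Q \<and> same_ray (z' - x) (R y) \<longleftrightarrow> z' = z)"
proof -
  have x: "x \<in> Q" and y: "y \<in> Q" and pos: "\<omega> (R x) (R y) > 0"
    using xy by (auto simp: phase_space_def)
  have "\<omega> (R y) (R x) < 0" using pos symplectic_form_antisym[OF form, of "R y" "R x"] by simp
  then obtain c where c: "c > 0" "x + c *\<^sub>R R y \<in> Q"
      "\<And>d. x + d *\<^sub>R R y \<in> Q \<Longrightarrow> d = 0 \<or> d = c" "\<omega> (R y) (R (x + c *\<^sub>R R y)) > 0"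
    using exists_chord_endpoint[OF x] by blast
  define z where "z = x + c *\<^sub>R R y"
  have line: "z' = z" if "z' \<in> Q" "z' - x = d *\<^sub>R R y" "d \<noteq> 0" for z' d
  proof -
    have "z' = x + d *\<^sub>R R y" using that(2) by (metis add.commute diff_add_cancel)
    then show ?thesis using c(3) that(1,3) by (auto simp: z_def)
  qed
  have "(THE z. z \<in> Q \<and> z \<noteq> x \<and> z - x \<in> characteristic_direction \<omega> Q y) = z"
  proof (rule the_equality)
    show "z \<in> Q \<and> z \<noteq> x \<and> z - x \<in> characteristic_direction \<omega> Q y"
      using c char_vector_nonzero[OF y] by (simp add: z_def characteristic_direction_eq[OF y])
  next
    fix z' assume "z' \<in> Q \<and> z' \<noteq> x \<and> z' - x \<in> characteristic_direction \<omega> Q y"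
    then show "z' = z" using line by (fastforce simp: characteristic_direction_eq[OF y])
  qed
  then have "symplectic_billiard_map \<omega> Q (x, y) = (y, z)"
    using xy by (simp add: symplectic_billiard_map_def)
  moreover have "(y, z) \<in> phase_space \<omega> Q Q" using c y by (simp add: phase_space_def z_def)
  moreover have "z' \<in> Q \<and> same_ray (z' - x) (R y) \<longleftrightarrow> z' = z" for z'
    using c line by (auto simp: same_ray_def z_def)
  ultimately show ?thesis by (intro exI[of _ z] conjI allI)
qed

lemma minkowski_eq_symplectic_squared:
  "minkowski_billiard_map \<omega> Q Q =
    compose (phase_space \<omega> Q Q) (symplectic_billiard_map \<omega> Q) (symplectic_billiard_map \<omega> Q)"
proof
  fix s :: "'a \<times> 'a"
  obtain x y where s: "s = (x, y)" by fastforce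
  show "minkowski_billiard_map \<omega> Q Q s =
    compose (phase_space \<omega> Q Q) (symplectic_billiard_map \<omega> Q) (symplectic_billiard_map \<omega> Q) s"
  proof (cases "(x, y) \<in> phase_space \<omega> Q Q")
    case True
    obtain z where z: "symplectic_billiard_map \<omega> Q (x, y) = (y, z)" "(y, z) \<in> phase_space \<omega> Q Q"
      "\<And>z'. z' \<in> Q \<and> same_ray (z' - x) (R y) \<longleftrightarrow> z' = z"
      using symplectic_billiard_step[OF True] by (elim exE conjE) simp
    obtain w where w: "symplectic_billiard_map \<omega> Q (y, z) = (z, w)"
      "\<And>w'. w' \<in> Q \<and> same_ray (w' - y) (R z) \<longleftrightarrow> w' = w"
      using symplectic_billiard_step[OF z(2)] by (elim exE conjE) simp
    have "(THE (q1, p1). q1 \<in> Q \<and> p1 \<in> Q \<and> same_ray (q1 - x) (R y) \<and> same_ray (p1 - y) (R q1))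
      = (z, w)"
    proof (rule the_equality, goal_cases)
      case 1
      show ?case using z(3)[of z] w(2)[of w] by simp
    next
      case (2 u)
      \<comment> \<open>The first component is forced to be \<open>z\<close>; only then does the
        condition on the second become the one for the step from \<open>(y, z)\<close>.\<close>
      then show ?case using z(3)[of "fst u"] w(2)[of "snd u"] by (cases u) auto
    qed
    then show ?thesis using True z w by (simp add: s minkowski_billiard_map_def compose_def)
  qed (simp add: s minkowski_billiard_map_def compose_def)
qed

end

theorem theorem3:
  fixes \<omega> :: "'a::euclidean_space \<Rightarrow> 'a \<Rightarrow> real" and Q P :: "'a set"
  assumes "symplectic_form \<omega>"
    and "strictly_convex_closed_C1_hypersurface Q" and "0 \<in> hypersurface_interior Q"
    and "strictly_convex_closed_C1_hypersurface P" and "0 \<in> hypersurface_interior P"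
    and "P = Q"
  shows "minkowski_billiard_map \<omega> Q P =
    compose (phase_space \<omega> Q Q) (symplectic_billiard_map \<omega> Q) (symplectic_billiard_map \<omega> Q)"
proof -
  obtain K where "bounds_strictly_convex_C1_body Q K" "0 \<in> interior K"
    using assms(3) by (auto simp: hypersurface_interior_def)
  then interpret symplectic_body \<omega> Q K
    using assms(1) by unfold_locales (auto simp: bounds_strictly_convex_C1_body_def)
  show ?thesis using minkowski_eq_symplectic_squared assms(6) by simp
qed

end
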